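(* Let $1<p<\infty$ and $p\ne2$. Then there is no constant $C\ge1$ such that $$\|f(T)\|\le C\sup_{z\in\overline{W(T)}}|f(z)|$$ for every polynomial $f$ and every operator $T\in\mathcal L(\ell_p)$.
   Context: $\ell_p=\ell_p(\mathbb N)$ is the complex sequence space and $\mathcal L(\ell_p)$ its algebra of bounded linear operators with the operator norm; polynomials are in one variable with complex coefficients. With $1/p+1/q=1$, the dual $(\ell_p)^*$ is identified with $\ell_q$ via $\langle x,y\rangle=\sum_j x_j\overline{y_j}$. For $x=(x_j)\in\ell_p$ put $J(x)=(x_j|x_j|^{p-2})_j\in\ell_q$ (with $0$ in the coordinates where $x_j=0$). The numerical range is $W(T)=\{\langle Tx,J(x)\rangle:\ x\in\ell_p,\ \|x\|_p=1\}$ and $\overline{W(T)}$ is its closure. *)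

theory Defs
  imports "HOL-Analysis.Analysis" "HOL-Computational_Algebra.Polynomial"
begin

text \<open>
  The exponent \<open>p\<close> is a real parameter, so \<open>\<ell>\<^sub>p\<close> is a carrier set of complex sequences
  (intended for \<open>1 < p\<close>) and operators are functions on sequences of which only the
  values on that carrier matter.
\<close>

definition lp :: "real \<Rightarrow> (nat \<Rightarrow> complex) set" where
  "lp p = {x. summable (\<lambda>j. norm (x j) powr p)}"

definition lp_norm :: "real \<Rightarrow> (nat \<Rightarrow> complex) \<Rightarrow> real" where
  "lp_norm p x = (\<Sum>j. norm (x j) powr p) powr (1 / p)"

definition lp_operators :: "real \<Rightarrow> ((nat \<Rightarrow> complex) \<Rightarrow> (nat \<Rightarrow> complex)) set" where
  "lp_operators p = {T.
     (\<forall>x\<in>lp p. T x \<in> lp p) \<and>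
     (\<forall>x\<in>lp p. \<forall>y\<in>lp p. T (\<lambda>j. x j + y j) = (\<lambda>j. T x j + T y j)) \<and>
     (\<forall>c. \<forall>x\<in>lp p. T (\<lambda>j. c * x j) = (\<lambda>j. c * T x j)) \<and>
     (\<exists>K. \<forall>x\<in>lp p. lp_norm p (T x) \<le> K * lp_norm p x)}"

definition lp_onorm :: "real \<Rightarrow> ((nat \<Rightarrow> complex) \<Rightarrow> (nat \<Rightarrow> complex)) \<Rightarrow> real" where
  "lp_onorm p T = (SUP x\<in>{x \<in> lp p. lp_norm p x \<le> 1}. lp_norm p (T x))"

definition poly_op ::
  "complex poly \<Rightarrow> ((nat \<Rightarrow> complex) \<Rightarrow> (nat \<Rightarrow> complex)) \<Rightarrow> (nat \<Rightarrow> complex) \<Rightarrow> (nat \<Rightarrow> complex)"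
  where "poly_op f T x = (\<lambda>j. \<Sum>i\<le>degree f. coeff f i * (T ^^ i) x j)"

definition seq_pairing :: "(nat \<Rightarrow> complex) \<Rightarrow> (nat \<Rightarrow> complex) \<Rightarrow> complex" where
  "seq_pairing x y = (\<Sum>j. x j * cnj (y j))"

text \<open>
  Coordinates with \<open>x j = 0\<close> are sent to \<open>0\<close>, also for \<open>p < 2\<close>, because of the factor \<open>x j\<close>.
\<close>

definition lp_J :: "real \<Rightarrow> (nat \<Rightarrow> complex) \<Rightarrow> (nat \<Rightarrow> complex)" where
  "lp_J p x = (\<lambda>j. x j * of_real (norm (x j) powr (p - 2)))"

definition numerical_range :: "real \<Rightarrow> ((nat \<Rightarrow> complex) \<Rightarrow> (nat \<Rightarrow> complex)) \<Rightarrow> complex set" where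
  "numerical_range p T = {seq_pairing (T x) (lp_J p x) | x. x \<in> lp p \<and> lp_norm p x = 1}"

end

theory Submission
  imports Defs
begin

text \<open>
  One operator, the unilateral right shift \<open>S\<close>, refutes every constant. Since \<open>S\<close> is an isometry,
  its numerical range lies in the closed unit disc, so the supremum over the numerical range is at
  most the supremum of \<open>norm (poly f z)\<close> over that disc. On the other hand \<open>f(S)\<close> is convolution
  with the coefficient sequence of \<open>f\<close>, and for \<open>p \<noteq> 2\<close> the norm of a convolution operator on
  \<open>\<ell>\<^sub>p\<close> is not controlled by the supremum norm of its symbol.

  The Rudin--Shapiro polynomials show the latter: with \<open>n = 2 ^ k\<close> coefficients, all of them
  \<open>1\<close> or \<open>-1\<close>, they are bounded by \<open>sqrt (2 * n)\<close> on the disc (\<open>norm_rudin_shapiro_le\<close>).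
  Applying \<open>f(S)\<close> to the first unit vector gives \<open>norm (f(S)) \<ge> n powr (1 / p)\<close>,
  which beats \<open>sqrt n\<close> if \<open>p < 2\<close> (\<open>onorm_rudin_shapiro_ge_unit\<close>). Applying it to the normalised
  sequence of reversed coefficients, so that all \<open>n\<close> products in one coordinate of the convolution
  are \<open>1\<close>, gives \<open>norm (f(S)) \<ge> n powr (1 - 1 / p)\<close>, which beats \<open>sqrt n\<close> if \<open>p > 2\<close>
  (\<open>onorm_rudin_shapiro_ge_reversed\<close>).
\<close>

section \<open>The right shift and its numerical range\<close>

definition right_shift :: "(nat \<Rightarrow> complex) \<Rightarrow> (nat \<Rightarrow> complex)" where
  "right_shift x = (\<lambda>j. if j = 0 then 0 else x (j - 1))"

lemma right_shift_funpow: "(right_shift ^^ i) x j = (if i \<le> j then x (j - i) else 0)"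
  by (induction i arbitrary: j) (auto simp: right_shift_def)

lemma right_shift_funpow_sums:
  assumes "x \<in> lp p"
  shows "(\<lambda>j. norm ((right_shift ^^ i) x j) powr p) sums (\<Sum>j. norm (x j) powr p)"
proof -
  have "(\<lambda>j. norm ((right_shift ^^ i) x (j + i)) powr p) sums (\<Sum>j. norm (x j) powr p)"
    using assms by (simp add: right_shift_funpow lp_def summable_sums)
  then show ?thesis
    by (subst (asm) sums_zero_iff_shift) (auto simp: right_shift_funpow)
qed

lemma right_shift_sums:
  assumes "x \<in> lp p"
  shows "(\<lambda>j. norm (right_shift x j) powr p) sums (\<Sum>j. norm (x j) powr p)"
  using right_shift_funpow_sums[OF assms, of 1] by simp

lemma right_shift_in_lp_operators: "right_shift \<in> lp_operators p"
proof -
  have "right_shift x \<in> lp p" "lp_norm p (right_shift x) \<le> 1 * lp_norm p x" if "x \<in> lp p" for x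
    using right_shift_sums[OF that] by (auto simp: lp_def lp_norm_def sums_iff)
  moreover have "right_shift (\<lambda>j. x j + y j) = (\<lambda>j. right_shift x j + right_shift y j)"
    and "right_shift (\<lambda>j. c * x j) = (\<lambda>j. c * right_shift x j)" for x y c
    by (auto simp: right_shift_def)
  ultimately show ?thesis
    unfolding lp_operators_def by blast
qed

lemma suminf_eq_lp_norm_powr:
  assumes "p > 0" "x \<in> lp p"
  shows "(\<Sum>j. norm (x j) powr p) = lp_norm p x powr p"
proof -
  have "(\<Sum>j. norm (x j) powr p) \<ge> 0"
    using assms by (intro suminf_nonneg) (auto simp: lp_def)
  then show ?thesis
    using assms by (simp add: lp_norm_def powr_powr)
qed

text \<open>
  This is Hoelder's inequality for \<open>right_shift x\<close> and \<open>lp_J p x\<close>. As \<open>x\<close> and its shift both have norm \<open>1\<close>, it suffices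
  to sum Young's inequality over the coordinates.
\<close>

lemma numerical_range_right_shift_subset:
  assumes "p > 1"
  shows "numerical_range p right_shift \<subseteq> cball 0 1"
proof -
  have "norm (seq_pairing (right_shift x) (lp_J p x)) \<le> 1" if x: "x \<in> lp p" "lp_norm p x = 1" for x
  proof -
    let ?q = "p / (p - 1)"
    have sum_x: "(\<Sum>j. norm (x j) powr p) = 1"
      using suminf_eq_lp_norm_powr[of p x] x assms by simp
    have sums_x: "(\<lambda>j. norm (x j) powr p) sums 1"
      using x(1) sum_x by (simp add: lp_def sums_iff)
    have sums_shift: "(\<lambda>j. norm (right_shift x j) powr p) sums 1"
      using right_shift_sums[OF x(1)] sum_x by simp
    have young: "norm (right_shift x j * cnj (lp_J p x j))
        \<le> norm (right_shift x j) powr p / p + norm (x j) powr p / ?q" for j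
    proof -
      have "norm (lp_J p x j) = norm (x j) powr (p - 1)"
        using powr_mult_base[of "norm (x j)" "p - 2"] by (simp add: lp_J_def norm_mult)
      then have "norm (right_shift x j * cnj (lp_J p x j))
          = norm (right_shift x j) * norm (x j) powr (p - 1)"
        by (simp add: norm_mult)
      also have "\<dots> \<le> norm (right_shift x j) powr p / p + (norm (x j) powr (p - 1)) powr ?q / ?q"
        using assms by (intro Youngs_inequality) (auto simp: field_simps)
      also have "(norm (x j) powr (p - 1)) powr ?q = norm (x j) powr p"
        using assms by (simp add: powr_powr)
      finally show ?thesis .
    qed
    have sums_bound: "(\<lambda>j. norm (right_shift x j) powr p / p + norm (x j) powr p / ?q)
        sums (1 / p + 1 / ?q)"
      using sums_shift sums_x by (intro sums_add sums_divide)
    have summable: "summable (\<lambda>j. norm (right_shift x j * cnj (lp_J p x j)))"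
      by (rule summable_comparison_test'[OF sums_summable[OF sums_bound], of 0])
         (use young in auto)
    have "norm (seq_pairing (right_shift x) (lp_J p x))
        \<le> (\<Sum>j. norm (right_shift x j * cnj (lp_J p x j)))"
      unfolding seq_pairing_def by (rule summable_norm[OF summable])
    also have "\<dots> \<le> 1 / p + 1 / ?q"
      using suminf_le[OF young summable sums_summable[OF sums_bound]] sums_bound
      by (simp add: sums_iff)
    also have "\<dots> = 1"
      using assms by (simp add: field_simps)
    finally show ?thesis .
  qed
  then show ?thesis
    by (auto simp: numerical_range_def)
qed

section \<open>Sequences of finite support and polynomials in the shift\<close>

lemma lp_norm_finite_support:
  assumes "\<And>j. j \<ge> n \<Longrightarrow> x j = 0"
  shows "x \<in> lp p" "lp_norm p x = (\<Sum>j<n. norm (x j) powr p) powr (1 / p)"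
proof -
  have "(\<lambda>j. norm (x j) powr p) sums (\<Sum>j<n. norm (x j) powr p)"
    by (rule sums_finite) (use assms in auto)
  then show "x \<in> lp p" "lp_norm p x = (\<Sum>j<n. norm (x j) powr p) powr (1 / p)"
    by (auto simp: lp_def lp_norm_def sums_iff)
qed

lemma norm_coord_le_lp_norm:
  assumes "p > 0" "x \<in> lp p"
  shows "norm (x j) \<le> lp_norm p x"
proof -
  have "norm (x j) powr p \<le> (\<Sum>i. norm (x i) powr p)"
    using assms sum_le_suminf[of "\<lambda>i. norm (x i) powr p" "{j}"] by (simp add: lp_def)
  then have "(norm (x j) powr p) powr (1 / p) \<le> lp_norm p x"
    unfolding lp_norm_def using assms by (intro powr_mono2) auto
  then show ?thesis
    using assms by (simp add: powr_powr)
qed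

lemma numerical_range_nonempty: "numerical_range p T \<noteq> {}"
proof -
  let ?e = "\<lambda>j::nat. if j = 0 then 1 else 0 :: complex"
  have "?e \<in> lp p" "lp_norm p ?e = 1"
    using lp_norm_finite_support[of 1 ?e p] by auto
  then show ?thesis
    by (auto simp: numerical_range_def)
qed

text \<open>
  A substitute for Minkowski's inequality whose crude constant is enough for boundedness: a sum is
  at most the number of terms times its largest term.
\<close>

lemma norm_sum_powr_le:
  fixes y :: "'a \<Rightarrow> complex"
  assumes "finite I" "p \<ge> 0"
  shows "norm (\<Sum>i\<in>I. y i) powr p \<le> real (card I) powr p * (\<Sum>i\<in>I. norm (y i) powr p)"
proof (cases "I = {}")
  case False
  define M where "M = Max ((\<lambda>i. norm (y i)) ` I)"
  have "M \<in> (\<lambda>i. norm (y i)) ` I"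
    unfolding M_def using assms False by (intro Max_in) auto
  then obtain i where i: "i \<in> I" "M = norm (y i)"
    by auto
  have "norm (\<Sum>i\<in>I. y i) \<le> real (card I) * M"
    using assms by (intro sum_norm_bound) (auto simp: M_def)
  then have "norm (\<Sum>i\<in>I. y i) powr p \<le> (real (card I) * M) powr p"
    using assms by (intro powr_mono2) auto
  also have "\<dots> = real (card I) powr p * norm (y i) powr p"
    using i by (simp add: powr_mult)
  also have "\<dots> \<le> real (card I) powr p * (\<Sum>i\<in>I. norm (y i) powr p)"
    using assms i by (intro mult_left_mono member_le_sum) auto
  finally show ?thesis .
qed simp

text \<open>
  The supremum defining \<open>lp_onorm\<close> says something only if it is taken over a bounded set, so
  this boundedness is needed to bound the operator norm from below by test vectors.
\<close>

lemma poly_op_right_shift_bounded: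
  assumes "p > 0"
  shows "x \<in> lp p \<Longrightarrow> poly_op f right_shift x \<in> lp p"
    and "bdd_above ((\<lambda>x. lp_norm p (poly_op f right_shift x)) ` {x \<in> lp p. lp_norm p x \<le> 1})"
proof -
  define A where "A = real (card {..degree f}) powr p * (\<Sum>i\<le>degree f. norm (coeff f i) powr p)"
  have A: "A \<ge> 0"
    unfolding A_def by (intro mult_nonneg_nonneg sum_nonneg) auto
  have bound: "poly_op f right_shift x \<in> lp p \<and>
      (\<Sum>j. norm (poly_op f right_shift x j) powr p) \<le> A * (\<Sum>j. norm (x j) powr p)"
    if x: "x \<in> lp p" for x
  proof -
    let ?g = "\<lambda>j. real (card {..degree f}) powr p *
      (\<Sum>i\<le>degree f. norm (coeff f i) powr p * norm ((right_shift ^^ i) x j) powr p)"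
    have le: "norm (poly_op f right_shift x j) powr p \<le> ?g j" for j
      using norm_sum_powr_le[of "{..degree f}" p "\<lambda>i. coeff f i * (right_shift ^^ i) x j"] assms
      by (simp add: poly_op_def norm_mult powr_mult)
    have "?g sums (real (card {..degree f}) powr p *
        (\<Sum>i\<le>degree f. norm (coeff f i) powr p * (\<Sum>j. norm (x j) powr p)))"
      by (intro sums_mult sums_sum right_shift_funpow_sums x)
    then have g: "?g sums (A * (\<Sum>j. norm (x j) powr p))"
      by (simp only: A_def sum_distrib_right mult.assoc)
    have summable: "summable (\<lambda>j. norm (poly_op f right_shift x j) powr p)"
      by (rule summable_comparison_test'[OF sums_summable[OF g], of 0]) (use le in auto)
    then show ?thesis
      using suminf_le[OF le summable sums_summable[OF g]] g by (simp add: lp_def sums_iff)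
  qed
  show "x \<in> lp p \<Longrightarrow> poly_op f right_shift x \<in> lp p"
    using bound by blast
  have "lp_norm p (poly_op f right_shift x) \<le> A powr (1 / p)"
    if x: "x \<in> lp p" "lp_norm p x \<le> 1" for x
  proof -
    have "(\<Sum>j. norm (x j) powr p) = lp_norm p x powr p"
      by (rule suminf_eq_lp_norm_powr[OF assms x(1)])
    also have "\<dots> \<le> 1"
      using x assms by (intro powr_le1) (auto simp: lp_norm_def)
    finally have "A * (\<Sum>j. norm (x j) powr p) \<le> A"
      using A by (simp add: mult_left_le)
    then have "(\<Sum>j. norm (poly_op f right_shift x j) powr p) \<le> A"
      using bound[OF x(1)] by linarith
    moreover have "(\<Sum>j. norm (poly_op f right_shift x j) powr p) \<ge> 0"
      using bound[OF x(1)] by (intro suminf_nonneg) (auto simp: lp_def)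
    ultimately show ?thesis
      unfolding lp_norm_def using assms by (intro powr_mono2) auto
  qed
  then show "bdd_above ((\<lambda>x. lp_norm p (poly_op f right_shift x)) ` {x \<in> lp p. lp_norm p x \<le> 1})"
    by (intro bdd_aboveI2) auto
qed

lemma lp_onorm_right_shift_ge:
  assumes "p > 0" "x \<in> lp p" "lp_norm p x \<le> 1"
  shows "lp_norm p (poly_op f right_shift x) \<le> lp_onorm p (poly_op f right_shift)"
  unfolding lp_onorm_def
  by (rule cSUP_upper) (use assms poly_op_right_shift_bounded(2) in auto)

section \<open>Rudin--Shapiro polynomials\<close>

fun rudin_shapiro :: "nat \<Rightarrow> complex poly \<times> complex poly" where
  "rudin_shapiro 0 = (1, 1)"
| "rudin_shapiro (Suc k) = (case rudin_shapiro k of (P, Q) \<Rightarrow>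
     (P + monom 1 (2 ^ k) * Q, P - monom 1 (2 ^ k) * Q))"

abbreviation rs_poly :: "nat \<Rightarrow> complex poly" where
  "rs_poly k \<equiv> fst (rudin_shapiro k)"

text \<open>
  The coefficients of \<open>P\<close> and of the shifted \<open>Q\<close> occupy disjoint ranges of indices, so a step of
  the recursion concatenates the two coefficient sequences, up to sign.
\<close>

lemma coeff_rudin_shapiro:
  assumes "rudin_shapiro k = (P, Q)"
  shows "i < 2 ^ k \<Longrightarrow> coeff P i \<in> {1, -1} \<and> coeff Q i \<in> {1, -1}"
    and "i \<ge> 2 ^ k \<Longrightarrow> coeff P i = 0 \<and> coeff Q i = 0"
proof -
  have "(i < 2 ^ k \<longrightarrow> coeff P i \<in> {1, -1} \<and> coeff Q i \<in> {1, -1}) \<and>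
        (i \<ge> 2 ^ k \<longrightarrow> coeff P i = 0 \<and> coeff Q i = 0)"
    using assms
  proof (induction k arbitrary: P Q i)
    case 0
    then show ?case by auto
  next
    case (Suc k)
    obtain P' Q' where PQ: "rudin_shapiro k = (P', Q')"
      by fastforce
    have P: "P = P' + monom 1 (2 ^ k) * Q'" and Q: "Q = P' - monom 1 (2 ^ k) * Q'"
      using Suc.prems PQ by auto
    show ?case
      using Suc.IH[OF PQ, of i] Suc.IH[OF PQ, of "i - 2 ^ k"]
      by (cases "i < 2 ^ k") (auto simp: P Q coeff_monom_mult)
  qed
  then show "i < 2 ^ k \<Longrightarrow> coeff P i \<in> {1, -1} \<and> coeff Q i \<in> {1, -1}"
    and "i \<ge> 2 ^ k \<Longrightarrow> coeff P i = 0 \<and> coeff Q i = 0"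
    by auto
qed

lemma coeff_rs_poly:
  "i < 2 ^ k \<Longrightarrow> coeff (rs_poly k) i = 1 \<or> coeff (rs_poly k) i = -1"
  "i \<ge> 2 ^ k \<Longrightarrow> coeff (rs_poly k) i = 0"
  using coeff_rudin_shapiro[of k "rs_poly k" "snd (rudin_shapiro k)" i] by auto

lemma degree_rs_poly: "degree (rs_poly k) = 2 ^ k - 1"
proof (rule antisym)
  show "degree (rs_poly k) \<le> 2 ^ k - 1"
    by (rule degree_le) (auto simp: coeff_rs_poly(2))
  show "2 ^ k - 1 \<le> degree (rs_poly k)"
    by (rule le_degree) (use coeff_rs_poly(1)[of "2 ^ k - 1" k] in auto)
qed

lemma parallelogram_law_complex:
  fixes a b :: complex
  shows "(norm (a + b))\<^sup>2 + (norm (a - b))\<^sup>2 = 2 * ((norm a)\<^sup>2 + (norm b)\<^sup>2)"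
  unfolding cmod_power2 by (simp add: power2_eq_square algebra_simps)

text \<open>
  The parallelogram law doubles the sum of the two squared moduli at each step of the recursion.
  The factor \<open>z ^ (2 ^ k)\<close> of the second polynomial can only decrease its modulus on the
  disc, so the bound holds there and not only on the circle.
\<close>

lemma norm_rudin_shapiro_sum_le:
  assumes "norm z \<le> 1" "rudin_shapiro k = (P, Q)"
  shows "(norm (poly P z))\<^sup>2 + (norm (poly Q z))\<^sup>2 \<le> 2 * 2 ^ k"
  using assms(2)
proof (induction k arbitrary: P Q)
  case 0
  then show ?case by auto
next
  case (Suc k)
  obtain P' Q' where PQ: "rudin_shapiro k = (P', Q')"
    by fastforce
  let ?a = "poly P' z" and ?b = "z ^ 2 ^ k * poly Q' z"
  have "poly P z = ?a + ?b" "poly Q z = ?a - ?b"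
    using Suc.prems PQ by (auto simp: poly_monom)
  then have "(norm (poly P z))\<^sup>2 + (norm (poly Q z))\<^sup>2 = 2 * ((norm ?a)\<^sup>2 + (norm ?b)\<^sup>2)"
    by (simp only: parallelogram_law_complex)
  also have "norm ?b \<le> norm (poly Q' z)"
    using assms(1) by (simp add: norm_mult norm_power power_le_one mult_left_le_one_le)
  then have "(norm ?b)\<^sup>2 \<le> (norm (poly Q' z))\<^sup>2"
    by (intro power_mono) auto
  then have "2 * ((norm ?a)\<^sup>2 + (norm ?b)\<^sup>2) \<le> 2 * ((norm ?a)\<^sup>2 + (norm (poly Q' z))\<^sup>2)"
    by simp
  also have "\<dots> \<le> 2 * (2 * 2 ^ k)"
    using Suc.IH[OF PQ] by simp
  finally show ?case by simp
qed

lemma norm_rudin_shapiro_le: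
  assumes "norm z \<le> 1"
  shows "norm (poly (rs_poly k) z) \<le> sqrt (2 * 2 ^ k)"
proof (rule real_le_rsqrt)
  show "(norm (poly (rs_poly k) z))\<^sup>2 \<le> 2 * 2 ^ k"
    using norm_rudin_shapiro_sum_le[OF assms prod.collapse[symmetric], of k]
      zero_le_power2[of "norm (poly (snd (rudin_shapiro k)) z)"] by linarith
qed

section \<open>Lower bounds for Rudin--Shapiro polynomials of the shift\<close>

lemma onorm_rudin_shapiro_ge_unit:
  assumes "p > 0"
  shows "(2 ^ k) powr (1 / p) \<le> lp_onorm p (poly_op (rs_poly k) right_shift)"
proof -
  let ?e = "\<lambda>j::nat. if j = 0 then 1 else 0 :: complex"
  have e: "?e \<in> lp p" "lp_norm p ?e = 1"
    using lp_norm_finite_support[of 1 ?e p] by auto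
  have eq: "poly_op (rs_poly k) right_shift ?e = coeff (rs_poly k)"
  proof
    fix j
    have "poly_op (rs_poly k) right_shift ?e j
        = (\<Sum>i\<le>degree (rs_poly k). if i = j then coeff (rs_poly k) i else 0)"
      unfolding poly_op_def by (intro sum.cong) (auto simp: right_shift_funpow)
    also have "\<dots> = coeff (rs_poly k) j"
      by (auto simp: coeff_eq_0)
    finally show "poly_op (rs_poly k) right_shift ?e j = coeff (rs_poly k) j" .
  qed
  have "norm (coeff (rs_poly k) j) powr p = 1" if "j < 2 ^ k" for j
    using coeff_rs_poly(1)[OF that] by auto
  then have "lp_norm p (coeff (rs_poly k)) = (2 ^ k) powr (1 / p)"
    using lp_norm_finite_support(2)[of "2 ^ k" "coeff (rs_poly k)" p] by (simp add: coeff_rs_poly(2))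
  then show ?thesis
    using lp_onorm_right_shift_ge[OF assms e(1), of "rs_poly k"] e(2) eq by simp
qed

text \<open>
  Coordinate \<open>2 ^ k - 1\<close> of the convolution with the reversed coefficients is the sum of the squares
  of all the coefficients.
\<close>

lemma onorm_rudin_shapiro_ge_reversed:
  assumes "p > 0"
  shows "(2 ^ k) powr (1 - 1 / p) \<le> lp_onorm p (poly_op (rs_poly k) right_shift)"
proof -
  define n :: nat where "n = 2 ^ k"
  have n: "n > 0"
    by (simp add: n_def)
  define s where "s = real n powr (- 1 / p)"
  define x where "x = (\<lambda>j. if j < n then of_real s * coeff (rs_poly k) (n - 1 - j) else 0)"
  have "norm (x j) powr p = 1 / real n" if "j < n" for j
  proof -
    have "n - 1 - j < 2 ^ k"
      using that by (simp add: n_def)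
    then have "norm (x j) = s"
      using coeff_rs_poly(1)[of "n - 1 - j" k] that by (auto simp: x_def s_def norm_mult)
    then have "norm (x j) powr p = real n powr (- 1 / p * p)"
      by (simp only: s_def powr_powr)
    then show ?thesis
      using assms n by (simp add: powr_minus_divide)
  qed
  then have x: "x \<in> lp p" "lp_norm p x = 1"
    using lp_norm_finite_support[of n x p] n by (auto simp: x_def)
  have "poly_op (rs_poly k) right_shift x (n - 1)
      = (\<Sum>i\<le>n - 1. coeff (rs_poly k) i * (right_shift ^^ i) x (n - 1))"
    by (simp add: poly_op_def degree_rs_poly n_def)
  also have "\<dots> = (\<Sum>i\<le>n - 1. of_real s)"
  proof (rule sum.cong)
    fix i assume "i \<in> {..n - 1}"
    then have i: "i < n" "i \<le> n - 1"
      using n by auto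
    then have "(right_shift ^^ i) x (n - 1) = of_real s * coeff (rs_poly k) i"
      by (auto simp: right_shift_funpow x_def)
    then show "coeff (rs_poly k) i * (right_shift ^^ i) x (n - 1) = of_real s"
      using coeff_rs_poly(1)[of i k] i by (auto simp: n_def)
  qed simp
  also have "\<dots> = of_real (real n * s)"
    using n by simp
  also have "real n * s = real n powr (1 - 1 / p)"
    using n powr_add[of "real n" 1 "- 1 / p"] by (simp add: s_def)
  finally have "real n powr (1 - 1 / p) = norm (poly_op (rs_poly k) right_shift x (n - 1))"
    by simp
  also have "\<dots> \<le> lp_norm p (poly_op (rs_poly k) right_shift x)"
    by (intro norm_coord_le_lp_norm poly_op_right_shift_bounded(1) assms x(1))
  also have "\<dots> \<le> lp_onorm p (poly_op (rs_poly k) right_shift)"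
    using x by (intro lp_onorm_right_shift_ge assms) auto
  finally show ?thesis
    by (simp add: n_def)
qed

section \<open>No constant works\<close>

lemma SUP_numerical_range_right_shift_le:
  assumes "p > 1"
  shows "(SUP z\<in>closure (numerical_range p right_shift). norm (poly (rs_poly k) z))
    \<le> sqrt (2 * 2 ^ k)"
proof (rule cSUP_least)
  show "closure (numerical_range p right_shift) \<noteq> {}"
    using numerical_range_nonempty by simp
  show "norm (poly (rs_poly k) z) \<le> sqrt (2 * 2 ^ k)"
    if "z \<in> closure (numerical_range p right_shift)" for z
    using that closure_minimal[OF numerical_range_right_shift_subset[OF assms]]
    by (intro norm_rudin_shapiro_le) auto
qed

theorem proposition4p15:
  fixes p :: real
  assumes "1 < p" and "p \<noteq> 2"
  shows "\<not> (\<exists>C::real. C \<ge> 1 \<and>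
           (\<forall>f :: complex poly. \<forall>T \<in> lp_operators p.
              lp_onorm p (poly_op f T) \<le> C * (SUP z\<in>closure (numerical_range p T). norm (poly f z))))"
proof
  assume "\<exists>C::real. C \<ge> 1 \<and>
           (\<forall>f :: complex poly. \<forall>T \<in> lp_operators p.
              lp_onorm p (poly_op f T) \<le> C * (SUP z\<in>closure (numerical_range p T). norm (poly f z)))"
  then obtain C where C: "C \<ge> 1"
    and bound: "\<And>f T. T \<in> lp_operators p \<Longrightarrow>
      lp_onorm p (poly_op f T) \<le> C * (SUP z\<in>closure (numerical_range p T). norm (poly f z))"
    by blast
  have upper: "lp_onorm p (poly_op (rs_poly k) right_shift) \<le> C * sqrt (2 * 2 ^ k)" for k
  proof -
    have "lp_onorm p (poly_op (rs_poly k) right_shift)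
        \<le> C * (SUP z\<in>closure (numerical_range p right_shift). norm (poly (rs_poly k) z))"
      by (rule bound[OF right_shift_in_lp_operators])
    also have "\<dots> \<le> C * sqrt (2 * 2 ^ k)"
      using C SUP_numerical_range_right_shift_le[OF assms(1)] by (intro mult_left_mono) auto
    finally show ?thesis .
  qed
  obtain m where m: "m > 1 / 2"
    and lower: "\<And>k. (2 ^ k) powr m \<le> lp_onorm p (poly_op (rs_poly k) right_shift)"
  proof (cases "p < 2")
    case True
    then show ?thesis
      using assms by (intro that[of "1 / p"] onorm_rudin_shapiro_ge_unit) (auto simp: field_simps)
  next
    case False
    then show ?thesis
      using assms
      by (intro that[of "1 - 1 / p"] onorm_rudin_shapiro_ge_reversed) (auto simp: field_simps)
  qed
  \<comment> \<open>Dividing the two bounds by \<open>sqrt (2 ^ k)\<close> leaves an unbounded geometric progression.\<close>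
  have "(2 powr (m - 1 / 2)) ^ k \<le> C * sqrt 2" for k
  proof -
    have "(2 powr (m - 1 / 2)) ^ k * sqrt (2 ^ k) = (2 ^ k) powr m"
      by (simp add: powr_half_sqrt[symmetric] powr_power powr_powr
          powr_add[symmetric] algebra_simps flip: powr_realpow)
    also have "\<dots> \<le> (C * sqrt 2) * sqrt (2 ^ k)"
      using order_trans[OF lower[of k] upper[of k]] by (simp add: real_sqrt_mult mult.assoc)
    finally show ?thesis
      by (simp add: mult_le_cancel_right)
  qed
  moreover obtain k where "C * sqrt 2 < (2 powr (m - 1 / 2)) ^ k"
    using real_arch_pow[of "2 powr (m - 1 / 2)"] m by auto
  ultimately show False
    by (meson not_less)
qed

end
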